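(* (The Schreier theorem for unified products) Let $H$ be a group, $(S,1_S)$ a pointed set and $\triangleleft$ a right action of $H$ on $S$. Then there exists a bijection between the set of objects of the skeleton of the category $\mathcal{D}(H,(S,1_S),\triangleleft)$ (i.e. the set of isomorphism classes of objects of this category) and the quotient set $\mathcal{H}^2_\ltimes(H,(S,1_S),\triangleleft)$.
   Context: Let $H$ be a group with unit $1_H$. An extending datum of $H$ is a system $\Omega(H) = \bigl((S,1_S,\ast),\triangleleft,\triangleright,f\bigr)$ where $(S,1_S)$ is a pointed set (a nonempty set $S$ with a fixed element $1_S\in S$), and $\ast : S\times S\to S$, $\triangleleft : S\times H\to S$, $\triangleright : S\times H\to H$, $f : S\times S\to H$ are maps such that for all $s\in S$, $h\in H$: $s\ast 1_S = 1_S\ast s = s$, $s\triangleleft 1_H = s$, $1_S\triangleleft h = 1_S$, $1_S\triangleright h = h$, $s\triangleright 1_H = 1_H$, $f(s,1_S) = f(1_S,s) = 1_H$. For an extending datum $\Omega(H)$, $H\ltimes_\Omega S$ denotes the set $H\times S$ with the binary operation $$(h_1,s_1)\cdot(h_2,s_2) := \bigl(h_1(s_1\triangleright h_2)f(s_1\triangleleft h_2,s_2),\ (s_1\triangleleft h_2)\ast s_2\bigr).$$ $\Omega(H)$ is called a group extending structure of $H$ if $H\ltimes_\Omega S$ is a group with this multiplication; $H\ltimes_\Omega S$ is then called the unified product. Fix $H$, $(S,1_S)$ and a right action $\triangleleft$ of $H$ on $S$. $\mathcal{SES}(H,(S,1_S),\triangleleft)$ denotes the set of all triples $(\ast,\triangleright,f)$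 such that $\bigl((S,1_S,\ast),\triangleleft,\triangleright,f\bigr)$ is a group extending structure of $H$. The category $\mathcal{D}(H,(S,1_S),\triangleleft)$ has $\mathcal{SES}(H,(S,1_S),\triangleleft)$ as its class of objects, and a morphism $(\ast,\triangleright,f)\to(\ast',\triangleright',f')$ is a morphism of groups $\psi : H\ltimes_\Omega S\to H\ltimes_{\Omega'}S$ between the associated unified products that stabilizes $H$ and $S$, i.e. $\psi(h,1_S) = (h,1_S)$ for all $h\in H$ and $\pi_S\circ\psi = \pi_S$, where $\pi_S(h,s) = s$. Two elements $(\ast,\triangleright,f)$ and $(\ast',\triangleright',f')$ of $\mathcal{SES}(H,(S,1_S),\triangleleft)$ are called cohomologous, written $\approx$, if there exists a map $r : S\to H$ with $r(1_S) = 1_H$ such that for all $s,s_1,s_2\in S$, $h\in H$: $$s_1\ast s_2 = \bigl(s_1\triangleleft r(s_2)\bigr)\ast' s_2,\qquad s\triangleright h = r(s)\,(s\triangleright' h)\,r(s\triangleleft h)^{-1},$$ $$f(s_1,s_2) = r(s_1)\,\bigl(s_1\triangleright' r(s_2)\bigr)\,f'\bigl(s_1\triangleleft r(s_2),\,s_2\bigr)\,r(s_1\ast s_2)^{-1}.$$ The relation $\approx$ is an equivalence relation on $\mathcal{SES}(H,(S,1_S),\triangleleft)$, and $\mathcal{H}^2_\ltimes(H,(S,1_S),\triangleleft) := \mathcal{SES}(H,(S,1_S),\triangleleft)/\approx$. *)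

theory Defs
  imports "HOL-Algebra.Group"
begin

text \<open>
  All structure maps are uncurried functions on products of carrier sets. Wherever such maps are
  collected into a set (objects and morphisms of the category below), they are required to be
  extensional, so that equality in HOL is equality of maps between the given sets.
\<close>

section \<open>Categories and isomorphism classes of objects\<close>

record ('o, 'm) cat =
  Obj :: "'o set"
  Hom :: "'o \<Rightarrow> 'o \<Rightarrow> 'm set"
  Ident :: "'o \<Rightarrow> 'm"
  Comp :: "'m \<Rightarrow> 'm \<Rightarrow> 'm"

text \<open>\<open>Comp C g f\<close> is \<open>g\<close> after \<open>f\<close>. Hom-sets of different pairs of objects may overlap as
  HOL sets; a morphism is always considered together with its source and target.\<close>

locale category =
  fixes C :: "('o, 'm) cat"
  assumes Ident_in: "x \<in> Obj C \<Longrightarrow> Ident C x \<in> Hom C x x"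
    and Comp_in: "\<lbrakk>x \<in> Obj C; y \<in> Obj C; z \<in> Obj C; f \<in> Hom C x y; g \<in> Hom C y z\<rbrakk>
      \<Longrightarrow> Comp C g f \<in> Hom C x z"
    and Comp_Ident: "\<lbrakk>x \<in> Obj C; y \<in> Obj C; f \<in> Hom C x y\<rbrakk> \<Longrightarrow> Comp C f (Ident C x) = f"
    and Ident_Comp: "\<lbrakk>x \<in> Obj C; y \<in> Obj C; f \<in> Hom C x y\<rbrakk> \<Longrightarrow> Comp C (Ident C y) f = f"
    and Comp_assoc: "\<lbrakk>w \<in> Obj C; x \<in> Obj C; y \<in> Obj C; z \<in> Obj C;
        f \<in> Hom C w x; g \<in> Hom C x y; h \<in> Hom C y z\<rbrakk>
      \<Longrightarrow> Comp C h (Comp C g f) = Comp C (Comp C h g) f"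

definition isomorphic_in :: "('o, 'm) cat \<Rightarrow> ('o \<times> 'o) set" where
  "isomorphic_in C = {(x, y). x \<in> Obj C \<and> y \<in> Obj C \<and>
     (\<exists>f \<in> Hom C x y. \<exists>g \<in> Hom C y x. Comp C g f = Ident C x \<and> Comp C f g = Ident C y)}"

definition iso_classes :: "('o, 'm) cat \<Rightarrow> 'o set set" where
  "iso_classes C = Obj C // isomorphic_in C"

lemma (in category) equiv_isomorphic_in: "equiv (Obj C) (isomorphic_in C)"
proof (rule equivI)
  show "isomorphic_in C \<subseteq> Obj C \<times> Obj C"
    by (auto simp: isomorphic_in_def)
  show "refl_on (Obj C) (isomorphic_in C)"
    by (rule refl_onI) (auto simp: isomorphic_in_def intro!: bexI[of _ "Ident C _"] Ident_in Comp_Ident)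
  show "sym (isomorphic_in C)"
    by (rule symI) (auto simp: isomorphic_in_def)
  show "trans (isomorphic_in C)"
  proof (rule transI)
    fix x y z
    assume "(x, y) \<in> isomorphic_in C" and "(y, z) \<in> isomorphic_in C"
    then obtain f g f' g' where o: "x \<in> Obj C" "y \<in> Obj C" "z \<in> Obj C"
      and m: "f \<in> Hom C x y" "g \<in> Hom C y x" "f' \<in> Hom C y z" "g' \<in> Hom C z y"
      and e: "Comp C g f = Ident C x" "Comp C f g = Ident C y"
        "Comp C g' f' = Ident C y" "Comp C f' g' = Ident C z"
      by (auto simp: isomorphic_in_def)
    have cancel: "Comp C (Comp C k k') (Comp C h' h) = Ident C a"
      if "a \<in> Obj C" "b \<in> Obj C" "c \<in> Obj C"
        "h \<in> Hom C a b" "h' \<in> Hom C b c" "k' \<in> Hom C c b" "k \<in> Hom C b a"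
        "Comp C k' h' = Ident C b" "Comp C k h = Ident C a" for a b c h h' k k'
    proof -
      have "Comp C (Comp C k k') (Comp C h' h) = Comp C k (Comp C k' (Comp C h' h))"
        using Comp_assoc[of a c b a "Comp C h' h" k' k] Comp_in[of a b c h h'] that by simp
      also have "Comp C k' (Comp C h' h) = h"
        using Comp_assoc[of a b c b h h' k'] Ident_Comp[of a b h] that by simp
      finally show ?thesis using that by simp
    qed
    have "Comp C (Comp C g g') (Comp C f' f) = Ident C x"
      using cancel[of x y z f f' g' g] o m e by simp
    moreover have "Comp C (Comp C f' f) (Comp C g g') = Ident C z"
      using cancel[of z y x g' g f f'] o m e by simp
    moreover have "Comp C f' f \<in> Hom C x z" "Comp C g g' \<in> Hom C z x"
      using Comp_in o m by blast+
    ultimately show "(x, z) \<in> isomorphic_in C"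
      using o unfolding isomorphic_in_def by blast
  qed
qed

section \<open>Extending structures and unified products\<close>

definition right_action :: "('h, 'b) monoid_scheme \<Rightarrow> 's set \<Rightarrow> ('s \<times> 'h \<Rightarrow> 's) \<Rightarrow> bool" where
  "right_action H S act \<longleftrightarrow>
     act \<in> S \<times> carrier H \<rightarrow> S \<and>
     (\<forall>s \<in> S. act (s, \<one>\<^bsub>H\<^esub>) = s) \<and>
     (\<forall>s \<in> S. \<forall>h \<in> carrier H. \<forall>h' \<in> carrier H. act (act (s, h), h') = act (s, h \<otimes>\<^bsub>H\<^esub> h'))"

text \<open>The triples \<open>(\<ast>, \<triangleright>, f)\<close>; the action \<open>\<triangleleft>\<close> and the point \<open>1\<^sub>S\<close> are separate
  parameters, called \<open>act\<close> and \<open>e\<close> throughout.\<close>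

type_synonym ('h, 's) ext_triple = "('s \<times> 's \<Rightarrow> 's) \<times> ('s \<times> 'h \<Rightarrow> 'h) \<times> ('s \<times> 's \<Rightarrow> 'h)"

definition extending_datum ::
  "('h, 'b) monoid_scheme \<Rightarrow> 's set \<Rightarrow> 's \<Rightarrow> ('s \<times> 'h \<Rightarrow> 's) \<Rightarrow> ('h, 's) ext_triple \<Rightarrow> bool" where
  "extending_datum H S e act = (\<lambda>(star, tri, f).
     e \<in> S \<and>
     star \<in> S \<times> S \<rightarrow> S \<and> act \<in> S \<times> carrier H \<rightarrow> S \<and>
     tri \<in> S \<times> carrier H \<rightarrow> carrier H \<and> f \<in> S \<times> S \<rightarrow> carrier H \<and>
     (\<forall>s \<in> S. star (s, e) = s \<and> star (e, s) = s) \<and>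
     (\<forall>s \<in> S. act (s, \<one>\<^bsub>H\<^esub>) = s) \<and>
     (\<forall>h \<in> carrier H. act (e, h) = e) \<and>
     (\<forall>h \<in> carrier H. tri (e, h) = h) \<and>
     (\<forall>s \<in> S. tri (s, \<one>\<^bsub>H\<^esub>) = \<one>\<^bsub>H\<^esub>) \<and>
     (\<forall>s \<in> S. f (s, e) = \<one>\<^bsub>H\<^esub> \<and> f (e, s) = \<one>\<^bsub>H\<^esub>))"

definition unified_product ::
  "('h, 'b) monoid_scheme \<Rightarrow> 's set \<Rightarrow> 's \<Rightarrow> ('s \<times> 'h \<Rightarrow> 's) \<Rightarrow> ('h, 's) ext_triple
    \<Rightarrow> ('h \<times> 's) monoid" where
  "unified_product H S e act = (\<lambda>(star, tri, f).
     \<lparr>carrier = carrier H \<times> S,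
      mult = (\<lambda>(h1, s1) (h2, s2).
        (h1 \<otimes>\<^bsub>H\<^esub> tri (s1, h2) \<otimes>\<^bsub>H\<^esub> f (act (s1, h2), s2), star (act (s1, h2), s2))),
      one = (\<one>\<^bsub>H\<^esub>, e)\<rparr>)"

text \<open>The unit stored in the record is no additional requirement: for an extending datum it is
  neutral for the multiplication.\<close>

lemma unified_product_one:
  assumes "group H" and "extending_datum H S e act X" and "p \<in> carrier (unified_product H S e act X)"
  defines "G \<equiv> unified_product H S e act X"
  shows "\<one>\<^bsub>G\<^esub> \<otimes>\<^bsub>G\<^esub> p = p" and "p \<otimes>\<^bsub>G\<^esub> \<one>\<^bsub>G\<^esub> = p"
proof -
  interpret group H by fact
  show "\<one>\<^bsub>G\<^esub> \<otimes>\<^bsub>G\<^esub> p = p" and "p \<otimes>\<^bsub>G\<^esub> \<one>\<^bsub>G\<^esub> = p"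
    using assms by (auto simp: G_def unified_product_def extending_datum_def)
qed

definition group_extending_structure ::
  "('h, 'b) monoid_scheme \<Rightarrow> 's set \<Rightarrow> 's \<Rightarrow> ('s \<times> 'h \<Rightarrow> 's) \<Rightarrow> ('h, 's) ext_triple \<Rightarrow> bool" where
  "group_extending_structure H S e act X \<longleftrightarrow>
     extending_datum H S e act X \<and> group (unified_product H S e act X)"

definition SES ::
  "('h, 'b) monoid_scheme \<Rightarrow> 's set \<Rightarrow> 's \<Rightarrow> ('s \<times> 'h \<Rightarrow> 's) \<Rightarrow> ('h, 's) ext_triple set" where
  "SES H S e act = {(star, tri, f).
     star \<in> extensional (S \<times> S) \<and> tri \<in> extensional (S \<times> carrier H) \<and> f \<in> extensional (S \<times> S) \<and>
     group_extending_structure H S e act (star, tri, f)}"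

section \<open>The category of unified products\<close>

definition stabilizing_homs ::
  "('h, 'b) monoid_scheme \<Rightarrow> 's set \<Rightarrow> 's \<Rightarrow> ('s \<times> 'h \<Rightarrow> 's)
    \<Rightarrow> ('h, 's) ext_triple \<Rightarrow> ('h, 's) ext_triple \<Rightarrow> ('h \<times> 's \<Rightarrow> 'h \<times> 's) set" where
  "stabilizing_homs H S e act X X' =
     {\<psi> \<in> hom (unified_product H S e act X) (unified_product H S e act X').
        \<psi> \<in> extensional (carrier H \<times> S) \<and>
        (\<forall>h \<in> carrier H. \<psi> (h, e) = (h, e)) \<and>
        (\<forall>p \<in> carrier H \<times> S. snd (\<psi> p) = snd p)}"

definition cat_D ::
  "('h, 'b) monoid_scheme \<Rightarrow> 's set \<Rightarrow> 's \<Rightarrow> ('s \<times> 'h \<Rightarrow> 's)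
    \<Rightarrow> (('h, 's) ext_triple, 'h \<times> 's \<Rightarrow> 'h \<times> 's) cat" where
  "cat_D H S e act =
     \<lparr>Obj = SES H S e act,
      Hom = stabilizing_homs H S e act,
      Ident = (\<lambda>_. \<lambda>p \<in> carrier H \<times> S. p),
      Comp = compose (carrier H \<times> S)\<rparr>"

lemma carrier_unified_product [simp]:
  "carrier (unified_product H S e act X) = carrier H \<times> S"
  by (simp add: unified_product_def split: prod.splits)

lemma category_cat_D: "category (cat_D H S e act)"
proof -
  have maps: "\<psi> \<in> carrier H \<times> S \<rightarrow> carrier H \<times> S"
    if "\<psi> \<in> stabilizing_homs H S e act X Y" for \<psi> X Y
    using that by (auto simp: stabilizing_homs_def hom_def)
  have ext: "\<psi> \<in> extensional (carrier H \<times> S)"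
    if "\<psi> \<in> stabilizing_homs H S e act X Y" for \<psi> X Y
    using that by (simp add: stabilizing_homs_def)
  have proj: "snd (\<psi> p) = snd p"
    if "\<psi> \<in> stabilizing_homs H S e act X Y" and "p \<in> carrier H \<times> S" for \<psi> X Y p
    using that(1)[unfolded stabilizing_homs_def mem_Collect_eq] that(2)
    by (elim conjE) (rule bspec)
  show ?thesis
  proof (unfold_locales, goal_cases)
    case (1 X)
    then have "group (unified_product H S e act X)" and e: "e \<in> S"
      by (auto simp: cat_D_def SES_def group_extending_structure_def extending_datum_def)
    then interpret G: group "unified_product H S e act X" by simp
    have "(\<lambda>p \<in> carrier H \<times> S. p) \<in> hom (unified_product H S e act X) (unified_product H S e act X)"
    proof (rule homI)
      fix p q assume pq: "p \<in> carrier (unified_product H S e act X)"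
        "q \<in> carrier (unified_product H S e act X)"
      show "(\<lambda>p \<in> carrier H \<times> S. p) (p \<otimes>\<^bsub>unified_product H S e act X\<^esub> q) =
        (\<lambda>p \<in> carrier H \<times> S. p) p \<otimes>\<^bsub>unified_product H S e act X\<^esub> (\<lambda>p \<in> carrier H \<times> S. p) q"
        using pq G.m_closed[OF pq] unfolding carrier_unified_product by (simp only: restrict_apply if_True)
    qed auto
    then show ?case using e by (simp add: cat_D_def stabilizing_homs_def)
  next
    case (2 X Y Z \<phi> \<psi>)
    then have \<phi>: "\<phi> \<in> stabilizing_homs H S e act X Y" and \<psi>: "\<psi> \<in> stabilizing_homs H S e act Y Z"
      and X: "X \<in> SES H S e act"
      by (simp_all add: cat_D_def)
    have gX: "group (unified_product H S e act X)" and e: "e \<in> S"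
      using X by (auto simp: SES_def group_extending_structure_def extending_datum_def)
    have "compose (carrier (unified_product H S e act X)) \<psi> \<phi>
        \<in> hom (unified_product H S e act X) (unified_product H S e act Z)"
      by (rule group.hom_compose[OF gX, of _ "unified_product H S e act Y"])
         (use \<phi> \<psi> in \<open>simp_all add: stabilizing_homs_def\<close>)
    moreover have "snd (compose (carrier H \<times> S) \<psi> \<phi> p) = snd p" if p: "p \<in> carrier H \<times> S" for p
    proof -
      have "\<phi> p \<in> carrier H \<times> S" using maps[OF \<phi>] p by (rule funcset_mem)
      then have "snd (\<psi> (\<phi> p)) = snd p" by (simp only: proj[OF \<psi>] proj[OF \<phi> p])
      then show ?thesis by (simp only: compose_eq[OF p])
    qed
    moreover have "compose (carrier H \<times> S) \<psi> \<phi> (h, e) = (h, e)" if h: "h \<in> carrier H" for h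
      using h e \<phi> \<psi> by (simp add: compose_def stabilizing_homs_def)
    ultimately have "compose (carrier H \<times> S) \<psi> \<phi> \<in> stabilizing_homs H S e act X Z"
      unfolding stabilizing_homs_def carrier_unified_product
      by (intro CollectI conjI ballI compose_extensional)
    then show ?case by (simp add: cat_D_def)
  next
    case (3 X Y \<phi>)
    then have "\<phi> \<in> stabilizing_homs H S e act X Y" by (simp add: cat_D_def)
    from compose_Id[OF maps[OF this] ext[OF this]] show ?case by (simp add: cat_D_def)
  next
    case (4 X Y \<phi>)
    then have "\<phi> \<in> stabilizing_homs H S e act X Y" by (simp add: cat_D_def)
    from Id_compose[OF maps[OF this] ext[OF this]] show ?case by (simp add: cat_D_def)
  next
    case (5 W X Y Z \<phi> \<psi> \<chi>)
    then have "\<phi> \<in> stabilizing_homs H S e act W X" by (simp add: cat_D_def)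
    from compose_assoc[OF maps[OF this]] show ?case by (simp add: cat_D_def)
  qed
qed

section \<open>Cohomologous structures\<close>

definition cohomologous ::
  "('h, 'b) monoid_scheme \<Rightarrow> 's set \<Rightarrow> 's \<Rightarrow> ('s \<times> 'h \<Rightarrow> 's)
    \<Rightarrow> (('h, 's) ext_triple \<times> ('h, 's) ext_triple) set" where
  "cohomologous H S e act = {((star, tri, f), (star', tri', f')).
     (star, tri, f) \<in> SES H S e act \<and> (star', tri', f') \<in> SES H S e act \<and>
     (\<exists>r \<in> S \<rightarrow> carrier H. r e = \<one>\<^bsub>H\<^esub> \<and>
       (\<forall>s1 \<in> S. \<forall>s2 \<in> S. star (s1, s2) = star' (act (s1, r s2), s2)) \<and>
       (\<forall>s \<in> S. \<forall>h \<in> carrier H.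
          tri (s, h) = r s \<otimes>\<^bsub>H\<^esub> tri' (s, h) \<otimes>\<^bsub>H\<^esub> inv\<^bsub>H\<^esub> (r (act (s, h)))) \<and>
       (\<forall>s1 \<in> S. \<forall>s2 \<in> S.
          f (s1, s2) = r s1 \<otimes>\<^bsub>H\<^esub> tri' (s1, r s2) \<otimes>\<^bsub>H\<^esub> f' (act (s1, r s2), s2)
            \<otimes>\<^bsub>H\<^esub> inv\<^bsub>H\<^esub> (r (star (s1, s2)))))}"

definition H2 ::
  "('h, 'b) monoid_scheme \<Rightarrow> 's set \<Rightarrow> 's \<Rightarrow> ('s \<times> 'h \<Rightarrow> 's) \<Rightarrow> ('h, 's) ext_triple set set" where
  "H2 H S e act = SES H S e act // cohomologous H S e act"

end

theory Submission
  imports Defs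
begin

text \<open>
  The isomorphism relation of the category and the relation of being cohomologous are the same
  relation on the set of objects, so the two quotients coincide and the identity is a bijection.

  In a unified product \<open>(h, s) = (h, e) \<cdot> (1, s)\<close>. A homomorphism \<open>\<psi>\<close> that stabilizes \<open>H\<close> and \<open>S\<close>
  is therefore determined by the first components \<open>r s\<close> of the values \<open>\<psi> (1, s)\<close>, and it is the
  shear \<open>(h, s) \<mapsto> (h \<cdot> r s, s)\<close> (\<open>stabilizing_hom_shear\<close>). This has two consequences. Shears are
  bijective, so every morphism is an isomorphism, and two objects are isomorphic as soon as there
  is a morphism between them (\<open>isomorphic_in_cat_D_iff\<close>). And a shear is multiplicative exactly
  when \<open>r\<close> satisfies the three cohomology equations (\<open>cohomologous_iff\<close>): they say that the shear
  respects the products \<open>(1, s\<^sub>1) \<cdot> (1, s\<^sub>2)\<close> and \<open>(1, s) \<cdot> (h, e)\<close>, and these determine all the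
  others, because \<open>(h\<^sub>1, s\<^sub>1) \<cdot> (h\<^sub>2, s\<^sub>2) = (h\<^sub>1, e) \<cdot> ((1, s\<^sub>1) \<cdot> (h\<^sub>2, e)) \<cdot> (1, s\<^sub>2)\<close>.
\<close>

locale ses_triple = group H for H (structure) +
  fixes S :: "'s set" and e :: 's and act star tri f
  assumes in_SES: "(star, tri, f) \<in> SES H S e act"
begin

abbreviation "G \<equiv> unified_product H S e act (star, tri, f)"

lemma datum: "extending_datum H S e act (star, tri, f)"
  using in_SES by (simp add: SES_def group_extending_structure_def)

sublocale G: group G
  using in_SES by (simp add: SES_def group_extending_structure_def)

lemma point_in [simp]: "e \<in> S"
  using datum by (simp add: extending_datum_def)

lemma closed [simp]:
  "\<lbrakk>s \<in> S; t \<in> S\<rbrakk> \<Longrightarrow> star (s, t) \<in> S"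
  "\<lbrakk>s \<in> S; h \<in> carrier H\<rbrakk> \<Longrightarrow> act (s, h) \<in> S"
  "\<lbrakk>s \<in> S; h \<in> carrier H\<rbrakk> \<Longrightarrow> tri (s, h) \<in> carrier H"
  "\<lbrakk>s \<in> S; t \<in> S\<rbrakk> \<Longrightarrow> f (s, t) \<in> carrier H"
  using datum by (auto simp: extending_datum_def)

lemma normalized [simp]:
  "s \<in> S \<Longrightarrow> star (s, e) = s" "s \<in> S \<Longrightarrow> star (e, s) = s"
  "s \<in> S \<Longrightarrow> act (s, \<one>) = s" "h \<in> carrier H \<Longrightarrow> act (e, h) = e"
  "h \<in> carrier H \<Longrightarrow> tri (e, h) = h" "s \<in> S \<Longrightarrow> tri (s, \<one>) = \<one>"
  "s \<in> S \<Longrightarrow> f (s, e) = \<one>" "s \<in> S \<Longrightarrow> f (e, s) = \<one>"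
  using datum by (auto simp: extending_datum_def)

lemma mult_G [simp]:
  "(h, s) \<otimes>\<^bsub>G\<^esub> (k, t) = (h \<otimes> tri (s, k) \<otimes> f (act (s, k), t), star (act (s, k), t))"
  by (simp add: unified_product_def)

text \<open>Both equations are associativity of \<open>G\<close> for \<open>(1, s)\<close>, \<open>(h, e)\<close> and \<open>(k, e)\<close>.\<close>

lemma
  assumes "s \<in> S" "h \<in> carrier H" "k \<in> carrier H"
  shows tri_mult: "tri (s, h \<otimes> k) = tri (s, h) \<otimes> tri (act (s, h), k)"
    and act_mult: "act (s, h \<otimes> k) = act (act (s, h), k)"
  using G.m_assoc[of "(\<one>, s)" "(h, e)" "(k, e)"] assms by simp_all

end

locale ses_pair = X: ses_triple H S e act star tri f + X': ses_triple H S e act star' tri' f'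
  for H (structure) and S :: "'s set" and e act star tri f star' tri' f'
begin

text \<open>Apply \<open>\<psi>\<close> to \<open>(h, s) = (h, e) \<cdot> (1, s)\<close>.\<close>

lemma stabilizing_hom_shear:
  assumes \<psi>: "\<psi> \<in> stabilizing_homs H S e act (star, tri, f) (star', tri', f')"
  obtains r where "r \<in> S \<rightarrow> carrier H" "r e = \<one>"
    "\<And>h s. \<lbrakk>h \<in> carrier H; s \<in> S\<rbrakk> \<Longrightarrow> \<psi> (h, s) = (h \<otimes> r s, s)"
proof -
  define r where "r = (\<lambda>s. fst (\<psi> (\<one>, s)))"
  have hom: "\<psi> \<in> hom X.G X'.G" and fix_H: "\<And>h. h \<in> carrier H \<Longrightarrow> \<psi> (h, e) = (h, e)"
    and fix_S: "\<And>p. p \<in> carrier H \<times> S \<Longrightarrow> snd (\<psi> p) = snd p"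
    using \<psi> unfolding stabilizing_homs_def by blast+
  have r: "r s \<in> carrier H" "\<psi> (\<one>, s) = (r s, s)" if "s \<in> S" for s
    using hom_in_carrier[OF hom, of "(\<one>, s)"] fix_S[of "(\<one>, s)"] that
    by (auto simp: r_def prod_eq_iff)
  have "\<psi> (h, s) = (h \<otimes> r s, s)" if "h \<in> carrier H" "s \<in> S" for h s
    using hom_mult[OF hom, of "(h, e)" "(\<one>, s)"] that r fix_H by simp
  moreover have "r e = \<one>"
    using fix_H[of \<one>] by (simp add: r_def)
  ultimately show thesis
    using that[of r] r by blast
qed

text \<open>Right translation by \<open>r s\<close> is a bijection on the fibre over each \<open>s\<close>.\<close>

lemma stabilizing_hom_bij:
  assumes "\<psi> \<in> stabilizing_homs H S e act (star, tri, f) (star', tri', f')"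
  shows "bij_betw \<psi> (carrier H \<times> S) (carrier H \<times> S)"
proof -
  obtain r where r: "r \<in> S \<rightarrow> carrier H"
    and \<psi>: "\<And>h s. \<lbrakk>h \<in> carrier H; s \<in> S\<rbrakk> \<Longrightarrow> \<psi> (h, s) = (h \<otimes> r s, s)"
    by (rule stabilizing_hom_shear[OF assms]) (rule that)
  have rs: "\<And>s. s \<in> S \<Longrightarrow> r s \<in> carrier H"
    using r by blast
  show ?thesis
    by (rule bij_betw_byWitness[where f' = "\<lambda>(h, s). (h \<otimes> inv (r s), s)"])
       (auto simp: \<psi> rs X.m_assoc)
qed

text \<open>The inverse of a bijective homomorphism is a homomorphism, and it again stabilizes
  \<open>H\<close> and \<open>S\<close>.\<close>

lemma isomorphic_in_cat_D_iff:
  "((star, tri, f), (star', tri', f')) \<in> isomorphic_in (cat_D H S e act) \<longleftrightarrow>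
    stabilizing_homs H S e act (star, tri, f) (star', tri', f') \<noteq> {}"
proof
  assume "stabilizing_homs H S e act (star, tri, f) (star', tri', f') \<noteq> {}"
  then obtain \<psi> where \<psi>: "\<psi> \<in> stabilizing_homs H S e act (star, tri, f) (star', tri', f')"
    by blast
  let ?P = "carrier H \<times> S"
  let ?\<phi> = "restrict (inv_into ?P \<psi>) ?P"
  have hom: "\<psi> \<in> hom X.G X'.G" and fix_H: "\<And>h. h \<in> carrier H \<Longrightarrow> \<psi> (h, e) = (h, e)"
    and fix_S: "\<And>p. p \<in> ?P \<Longrightarrow> snd (\<psi> p) = snd p"
    using \<psi> unfolding stabilizing_homs_def by blast+
  note bij = stabilizing_hom_bij[OF \<psi>]
  have "inv_into ?P \<psi> \<in> hom X'.G X.G"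
    using X.G.iso_set_sym[of \<psi> X'.G] hom bij by (auto simp: iso_def)
  then have "?\<phi> \<in> hom X'.G X.G"
    using X'.G.restrict_hom_iff[of "inv_into ?P \<psi>" "\<lambda>_. undefined" X.G]
    by (simp add: restrict_def)
  moreover have "?\<phi> (h, e) = (h, e)" if "h \<in> carrier H" for h
    using bij_betw_inv_into_left[OF bij, of "(h, e)"] fix_H that by simp
  moreover have "snd (?\<phi> p) = snd p" if "p \<in> ?P" for p
    using fix_S[of "?\<phi> p"] bij_betw_inv_into_right[OF bij that]
      bij_betwE[OF bij_betw_inv_into[OF bij]] that by (metis restrict_apply')
  ultimately have "?\<phi> \<in> stabilizing_homs H S e act (star', tri', f') (star, tri, f)"
    unfolding stabilizing_homs_def by blast
  moreover have "compose ?P ?\<phi> \<psi> = (\<lambda>p \<in> ?P. p)" "compose ?P \<psi> ?\<phi> = (\<lambda>p \<in> ?P. p)"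
    using bij_betw_inv_into_left[OF bij] bij_betw_inv_into_right[OF bij] bij_betwE[OF bij]
    by (auto simp: compose_def fun_eq_iff)
  ultimately show "((star, tri, f), (star', tri', f')) \<in> isomorphic_in (cat_D H S e act)"
    using \<psi> X.in_SES X'.in_SES unfolding isomorphic_in_def cat_D_def by auto
qed (auto simp: isomorphic_in_def cat_D_def)

text \<open>From left to right the witness is the shear by \<open>r\<close>. From right to left the equations are
  read off from the values of the homomorphism on \<open>(1, s) \<cdot> (1, t)\<close> and \<open>(1, s) \<cdot> (h, e)\<close>.\<close>

lemma cohomologous_iff:
  "((star, tri, f), (star', tri', f')) \<in> cohomologous H S e act \<longleftrightarrow>
    stabilizing_homs H S e act (star, tri, f) (star', tri', f') \<noteq> {}"
proof
  assume "((star, tri, f), (star', tri', f')) \<in> cohomologous H S e act"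
  then obtain r where r: "r \<in> S \<rightarrow> carrier H" and r_point: "r e = \<one>"
    and eqs: "\<forall>s \<in> S. \<forall>t \<in> S. star (s, t) = star' (act (s, r t), t)"
      "\<forall>s \<in> S. \<forall>h \<in> carrier H. tri (s, h) = r s \<otimes> tri' (s, h) \<otimes> inv (r (act (s, h)))"
      "\<forall>s \<in> S. \<forall>t \<in> S.
        f (s, t) = r s \<otimes> tri' (s, r t) \<otimes> f' (act (s, r t), t) \<otimes> inv (r (star (s, t)))"
    unfolding cohomologous_def mem_Collect_eq prod.case by (elim conjE bexE) (rule that)
  note star = eqs(1)[rule_format] and tri = eqs(2)[rule_format] and f = eqs(3)[rule_format]
  have rs [simp]: "\<And>s. s \<in> S \<Longrightarrow> r s \<in> carrier H"
    using r by blast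
  define \<psi> where "\<psi> = (\<lambda>(h, s) \<in> carrier H \<times> S. (h \<otimes> r s, s))"
  have \<psi>: "\<psi> (h, s) = (h \<otimes> r s, s)" if "h \<in> carrier H" "s \<in> S" for h s
    using that by (simp add: \<psi>_def)
  have mult: "\<psi> ((h, s) \<otimes>\<^bsub>X.G\<^esub> (k, t)) = \<psi> (h, s) \<otimes>\<^bsub>X'.G\<^esub> \<psi> (k, t)"
    if [simp]: "h \<in> carrier H" "s \<in> S" "k \<in> carrier H" "t \<in> S" for h s k t
  proof -
    let ?u = "act (s, k)"
    \<comment> \<open>The equation for \<open>tri (s, k)\<close> ends in \<open>inv (r ?u)\<close> and that for \<open>f (?u, t)\<close> begins with
      \<open>r ?u\<close>. Once these cancel, \<open>tri'\<close> and \<open>act\<close> can be collected on the product \<open>k \<otimes> r t\<close>.\<close>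
    have "tri (s, k) \<otimes> f (?u, t) \<otimes> r (star (?u, t)) =
        r s \<otimes> tri' (s, k) \<otimes> (inv (r ?u) \<otimes> (r ?u \<otimes> (tri' (?u, r t) \<otimes> f' (act (?u, r t), t))))"
      by (simp add: tri f X.m_assoc)
    also have "\<dots> = r s \<otimes> tri' (s, k \<otimes> r t) \<otimes> f' (act (s, k \<otimes> r t), t)"
      by (simp add: X'.tri_mult X'.act_mult flip: X.m_assoc)
    finally have "h \<otimes> (tri (s, k) \<otimes> f (?u, t) \<otimes> r (star (?u, t))) =
        h \<otimes> (r s \<otimes> tri' (s, k \<otimes> r t) \<otimes> f' (act (s, k \<otimes> r t), t))"
      by simp
    then show ?thesis
      using star[of ?u t] by (simp add: \<psi> X'.act_mult X.m_assoc)
  qed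
  have "\<psi> \<in> hom X.G X'.G"
    using mult by (auto intro!: homI simp: \<psi> simp del: X.mult_G X'.mult_G)
  then have "\<psi> \<in> stabilizing_homs H S e act (star, tri, f) (star', tri', f')"
    unfolding stabilizing_homs_def by (auto simp: \<psi> r_point) (simp add: \<psi>_def)
  then show "stabilizing_homs H S e act (star, tri, f) (star', tri', f') \<noteq> {}"
    by blast
next
  assume "stabilizing_homs H S e act (star, tri, f) (star', tri', f') \<noteq> {}"
  then obtain \<psi> where \<psi>: "\<psi> \<in> stabilizing_homs H S e act (star, tri, f) (star', tri', f')"
    by blast
  then have hom: "\<psi> \<in> hom X.G X'.G"
    unfolding stabilizing_homs_def by blast
  obtain r where r: "r \<in> S \<rightarrow> carrier H" and r_point: "r e = \<one>"
    and shear: "\<And>h s. \<lbrakk>h \<in> carrier H; s \<in> S\<rbrakk> \<Longrightarrow> \<psi> (h, s) = (h \<otimes> r s, s)"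
    by (rule stabilizing_hom_shear[OF \<psi>]) (rule that)
  have rs [simp]: "\<And>s. s \<in> S \<Longrightarrow> r s \<in> carrier H"
    using r by blast
  have S_S: "star (s, t) = star' (act (s, r t), t)"
    "f (s, t) \<otimes> r (star (s, t)) = r s \<otimes> tri' (s, r t) \<otimes> f' (act (s, r t), t)"
    if "s \<in> S" "t \<in> S" for s t
    using hom_mult[OF hom, of "(\<one>, s)" "(\<one>, t)"] that by (auto simp: shear)
  have S_H: "tri (s, h) \<otimes> r (act (s, h)) = r s \<otimes> tri' (s, h)"
    if "s \<in> S" "h \<in> carrier H" for s h
    using hom_mult[OF hom, of "(\<one>, s)" "(h, e)"] that by (simp add: shear r_point)
  have "tri (s, h) = r s \<otimes> tri' (s, h) \<otimes> inv (r (act (s, h)))"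
    if "s \<in> S" "h \<in> carrier H" for s h
    using S_H[OF that] that by (simp add: X.inv_solve_right)
  moreover have "f (s, t) = r s \<otimes> tri' (s, r t) \<otimes> f' (act (s, r t), t) \<otimes> inv (r (star (s, t)))"
    if "s \<in> S" "t \<in> S" for s t
    using S_S(2)[OF that] that by (simp add: X.inv_solve_right)
  ultimately show "((star, tri, f), (star', tri', f')) \<in> cohomologous H S e act"
    using X.in_SES X'.in_SES r r_point S_S(1) unfolding cohomologous_def mem_Collect_eq prod.case by blast
qed

end

lemma isomorphic_in_cat_D_eq_cohomologous:
  assumes "group H"
  shows "isomorphic_in (cat_D H S e act) = cohomologous H S e act"
proof -
  have "(X, X') \<in> isomorphic_in (cat_D H S e act) \<longleftrightarrow> (X, X') \<in> cohomologous H S e act"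
    if X: "X \<in> SES H S e act" "X' \<in> SES H S e act" for X X'
  proof -
    obtain star tri f star' tri' f' where eq: "X = (star, tri, f)" "X' = (star', tri', f')"
      by (cases X, cases X')
    interpret group H by fact
    interpret ses_pair H S e act star tri f star' tri' f'
      by unfold_locales (use X eq in auto)
    show ?thesis
      unfolding eq isomorphic_in_cat_D_iff cohomologous_iff ..
  qed
  moreover have "isomorphic_in (cat_D H S e act) \<subseteq> SES H S e act \<times> SES H S e act"
    by (auto simp: isomorphic_in_def cat_D_def)
  moreover have "cohomologous H S e act \<subseteq> SES H S e act \<times> SES H S e act"
    by (auto simp: cohomologous_def)
  ultimately show ?thesis
    by blast
qed

theorem corollary2p20:
  fixes H :: "('h, 'b) monoid_scheme"
    and S :: "'s set" and e :: 's
    and act :: "'s \<times> 'h \<Rightarrow> 's"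
  assumes "group H"
    and "e \<in> S"
    and "right_action H S act"
  shows "\<exists>F. bij_betw F (iso_classes (cat_D H S e act)) (H2 H S e act)"
proof -
  have "iso_classes (cat_D H S e act) = H2 H S e act"
    unfolding iso_classes_def H2_def isomorphic_in_cat_D_eq_cohomologous[OF assms(1)]
    by (simp add: cat_D_def)
  then have "bij_betw id (iso_classes (cat_D H S e act)) (H2 H S e act)"
    by simp
  then show ?thesis
    by blast
qed

end
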